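(* Every nondegenerate zero-dimensional separable metric space $(X,d)$ (in particular, the Cantor space) has the $\mathcal{AF}$-property.
   Context: A space is nondegenerate if it has at least two points. Zero-dimensional means having a base of clopen sets. For a metrizable space $X$, a continuous map $f\colon X\to X$ and a point $x\in X$, the $\alpha$-limit set of $x$ is $\alpha_f(x)=\bigcap_{n\ge 0}\overline{\bigcup_{k\ge n} f^{-k}(x)}$, where $f^{-k}(x)=\{y\in X: f^k(y)=x\}$. A set $A\subseteq X$ is an $\alpha$-limit set in $X$ if $A=\alpha_f(x)$ for some continuous $f\colon X\to X$ and some $x\in X$. A metrizable space $X$ has the $\mathcal{AF}$-property if the $\alpha$-limit sets in $X$ are precisely the closed subsets of $X$ (including $\emptyset$ and $X$). *)

theory Defs
  imports "HOL-Analysis.Analysis"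
begin

definition nondegenerate_space :: "'a topology \<Rightarrow> bool" where
  "nondegenerate_space X \<longleftrightarrow> (\<exists>x\<in>topspace X. \<exists>y\<in>topspace X. x \<noteq> y)"

definition zero_dimensional_space :: "'a topology \<Rightarrow> bool" where
  "zero_dimensional_space X \<longleftrightarrow>
     (\<exists>\<B>. (\<forall>V\<in>\<B>. openin X V \<and> closedin X V) \<and>
          (\<forall>U x. openin X U \<and> x \<in> U \<longrightarrow> (\<exists>V\<in>\<B>. x \<in> V \<and> V \<subseteq> U)))"

definition alpha_limit :: "'a topology \<Rightarrow> ('a \<Rightarrow> 'a) \<Rightarrow> 'a \<Rightarrow> 'a set" where
  "alpha_limit X f x =
     (\<Inter>n::nat. X closure_of (\<Union>k\<in>{n..}. {y \<in> topspace X. (f ^^ k) y = x}))"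

definition is_alpha_limit_set :: "'a topology \<Rightarrow> 'a set \<Rightarrow> bool" where
  "is_alpha_limit_set X A \<longleftrightarrow>
     (\<exists>f x. continuous_map X X f \<and> x \<in> topspace X \<and> A = alpha_limit X f x)"

definition AF_property :: "'a topology \<Rightarrow> bool" where
  "AF_property X \<longleftrightarrow>
     metrizable_space X \<and> (\<forall>A. is_alpha_limit_set X A \<longleftrightarrow> closedin X A)"

definition Cantor_space :: "(nat \<Rightarrow> bool) topology" where
  "Cantor_space = product_topology (\<lambda>_. discrete_topology UNIV) UNIV"

end

theory Submission
  imports Defs
begin

text \<open>
  Every \<open>\<alpha>\<close>-limit set is an intersection of closures, hence closed.  For the converse, let \<open>A\<close> be
  closed.  If \<open>A\<close> is empty, a constant map with value \<open>y \<noteq> x\<close>, available by nondegeneracy, leaves \<open>x\<close>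
  without preimages.  If \<open>A\<close> is nonempty, it suffices to find \<open>x \<in> A\<close> and a
  continuous \<open>f\<close> that collapses \<open>A\<close> to \<open>x\<close> and maps the complement of \<open>A\<close> into itself: then
  for every \<open>k \<ge> 1\<close> the preimage of \<open>x\<close> under \<open>f ^^ k\<close> is exactly \<open>A\<close> (lemma \<open>alpha_limit_collapse\<close>).

  For clopen \<open>A\<close> such an \<open>f\<close> can take just two values.  Otherwise \<open>A\<close> has a point \<open>x\<close> outside its
  interior, so some sequence \<open>y n\<close> in the complement converges to \<open>x\<close>.  Zero-dimensionality together
  with second countability cuts the complement into clopen pieces \<open>P 0, P 1, \<dots>\<close>, and \<open>f\<close> sends \<open>P n\<close>
  to the single point \<open>y n\<close>.  Continuity on the complement is clear; at points of \<open>A\<close> it holds because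
  a neighbourhood of \<open>A\<close> is obtained by removing any finite number of pieces, and on it \<open>f\<close> takes only
  the value \<open>x\<close> and late terms of the sequence (lemma \<open>continuous_map_collapse_pieces\<close>).
\<close>

section \<open>Limit sets of collapsing maps\<close>

lemma closedin_alpha_limit: "closedin X (alpha_limit X f x)"
  unfolding alpha_limit_def by (intro closedin_INT) auto

text \<open>
  The fixed point \<open>x\<close> absorbs all of \<open>A\<close> after one step and its complement never reaches \<open>A\<close>, so
  the preimage under \<open>f ^^ k\<close> does not depend on \<open>k \<ge> 1\<close>.
\<close>
lemma alpha_limit_collapse:
  assumes A: "closedin X A" and x: "x \<in> A"
    and inA: "\<And>z. z \<in> A \<Longrightarrow> f z = x"
    and outA: "f \<in> topspace X - A \<rightarrow> topspace X - A"
  shows "alpha_limit X f x = A"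
proof -
  have sub: "A \<subseteq> topspace X"
    using A closedin_subset by blast
  have absorbed: "(f ^^ Suc k) z = x" if "z \<in> A" for z k
    by (induction k) (use inA that x in auto)
  have escaping: "(f ^^ k) z \<in> topspace X - A" if "z \<in> topspace X - A" for z k
    by (induction k) (use outA that in auto)
  have "(\<Union>k\<in>{n..}. {y \<in> topspace X. (f ^^ k) y = x}) = A" for n
  proof
    show "(\<Union>k\<in>{n..}. {y \<in> topspace X. (f ^^ k) y = x}) \<subseteq> A"
      using escaping x by blast
    show "A \<subseteq> (\<Union>k\<in>{n..}. {y \<in> topspace X. (f ^^ k) y = x})"
    proof
      fix z assume "z \<in> A"
      then have "z \<in> {y \<in> topspace X. (f ^^ Suc n) y = x}"
        using absorbed sub by blast
      then show "z \<in> (\<Union>k\<in>{n..}. {y \<in> topspace X. (f ^^ k) y = x})"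
        by (intro UN_I[of "Suc n"]) auto
    qed
  qed
  then show ?thesis
    using A by (simp add: alpha_limit_def closure_of_closedin)
qed

section \<open>Clopen pieces of an open set\<close>

text \<open>
  A countable base need not consist of clopen sets; the Lindelof property of \<open>U\<close> extracts a
  countable subfamily from the cover by clopen subsets, which is then made disjoint.
\<close>
lemma open_eq_disjoint_UN_clopen:
  assumes zero: "zero_dimensional_space X" and count: "second_countable X" and U: "openin X U"
  obtains P :: "nat \<Rightarrow> 'a set"
  where "\<And>n. openin X (P n)" "\<And>n. closedin X (P n)" "(\<Union>n. P n) = U" "disjoint_family P"
proof -
  obtain \<B> where clopen: "\<And>V. V \<in> \<B> \<Longrightarrow> openin X V \<and> closedin X V"
    and base: "\<And>W x. openin X W \<and> x \<in> W \<Longrightarrow> \<exists>V\<in>\<B>. x \<in> V \<and> V \<subseteq> W"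
    using zero unfolding zero_dimensional_space_def by metis
  define \<U> where "\<U> = {V \<in> \<B>. V \<subseteq> U}"
  have top: "topspace (subtopology X U) = U"
    by (metis U openin_subset topspace_subtopology_subset)
  have "Lindelof_space (subtopology X U)"
    by (intro second_countable_imp_Lindelof_space second_countable_subtopology count)
  moreover have "openin (subtopology X U) V" if "V \<in> \<U>" for V
    using that clopen U by (auto simp: \<U>_def openin_open_subtopology)
  moreover have "\<Union>\<U> = U"
    unfolding \<U>_def using base[of U] U by blast
  ultimately have "\<exists>\<V>. countable \<V> \<and> \<V> \<subseteq> \<U> \<and> \<Union>\<V> = U"
    using Lindelof_spaceD[of "subtopology X U" \<U>] top by simp
  then obtain \<V> where \<V>: "countable \<V>" "\<V> \<subseteq> \<U>" "\<Union>\<V> = U"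
    by (elim exE conjE)
  \<comment> \<open>Adjoining the empty set makes the family nonempty, so that it can be enumerated.\<close>
  define V where "V = from_nat_into (insert {} \<V>)"
  have range: "range V = insert {} \<V>"
    unfolding V_def using \<V>(1) by (simp add: range_from_nat_into)
  have cl: "openin X (V n) \<and> closedin X (V n)" for n
  proof -
    have "V n \<in> insert {} \<V>" using range by blast
    then show ?thesis using \<V>(2) clopen by (auto simp: \<U>_def)
  qed
  show thesis
  proof
    show "openin X (disjointed V n)" for n
      unfolding disjointed_def by (intro openin_diff closedin_Union) (use cl in auto)
    show "closedin X (disjointed V n)" for n
      unfolding disjointed_def by (intro closedin_diff openin_Union) (use cl in auto)
    show "(\<Union>n. disjointed V n) = U"
      using \<V>(3) range by (simp add: UN_disjointed_eq)
    show "disjoint_family (disjointed V)"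
      by (rule disjoint_family_disjointed)
  qed
qed

text \<open>
  The preimage of an open set is a union of pieces if it misses \<open>x\<close>; if it contains \<open>x\<close>, convergence
  leaves only finitely many pieces outside, and these have a closed union.
\<close>
lemma continuous_map_collapse_pieces:
  assumes P: "\<And>n. openin X (P n)" "\<And>n. closedin X (P n)" "(\<Union>n. P n) = topspace X - A"
    and x: "x \<in> topspace X" and y: "range y \<subseteq> topspace X" and lim: "limitin X y x sequentially"
    and fA: "\<And>z. z \<in> topspace X \<inter> A \<Longrightarrow> f z = x" and fP: "\<And>n z. z \<in> P n \<Longrightarrow> f z = y n"
  shows "continuous_map X X f"
  unfolding continuous_map
proof (intro conjI allI impI)
  show "f ` topspace X \<subseteq> topspace X"
  proof clarify
    fix z assume "z \<in> topspace X"
    then have "z \<in> topspace X \<inter> A \<or> (\<exists>n. z \<in> P n)"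
      using P(3) by blast
    then show "f z \<in> topspace X"
      using x y fA fP by (metis range_subsetD)
  qed
next
  fix W assume W: "openin X W"
  show "openin X {z \<in> topspace X. f z \<in> W}"
  proof (cases "x \<in> W")
    case True
    then have "eventually (\<lambda>n. y n \<in> W) sequentially"
      using lim W by (simp add: limitin_def)
    then have fin: "finite {n. y n \<notin> W}"
      by (simp add: eventually_cofinite flip: cofinite_eq_sequentially)
    have "{z \<in> topspace X. f z \<in> W} = topspace X - (\<Union>n\<in>{n. y n \<notin> W}. P n)"
      using P(3) fA fP True by (auto simp: set_eq_iff) metis+
    moreover have "closedin X (\<Union>n\<in>{n. y n \<notin> W}. P n)"
      using fin P(2) by (intro closedin_Union) auto
    ultimately show ?thesis
      by (metis openin_diff openin_topspace)
  next
    case False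
    then have "{z \<in> topspace X. f z \<in> W} = (\<Union>n\<in>{n. y n \<in> W}. P n)"
      using P(3) fA fP by (auto simp: set_eq_iff) metis+
    then show ?thesis
      using P(1) by auto
  qed
qed

section \<open>Realising closed sets\<close>

lemma empty_is_alpha_limit_set:
  fixes X :: "'a topology"
  assumes "nondegenerate_space X"
  shows "is_alpha_limit_set X {}"
proof -
  obtain x y where xy: "x \<in> topspace X" "y \<in> topspace X" "x \<noteq> y"
    using assms unfolding nondegenerate_space_def by blast
  define c where "c = (\<lambda>_::'a. y)"
  have "(c ^^ Suc k) z = y" for k z
    by (induction k) (auto simp: c_def)
  then have "(c ^^ k) z \<noteq> x" if "k \<ge> 1" for k z
    using that xy(3) by (metis Suc_le_D One_nat_def)
  then have "(\<Union>k\<in>{1..}. {z \<in> topspace X. (c ^^ k) z = x}) = {}"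
    by auto
  then have "alpha_limit X c x \<subseteq> X closure_of {}"
    unfolding alpha_limit_def by (metis (no_types, lifting) INT_lower UNIV_I)
  then have "alpha_limit X c x = {}"
    by simp
  moreover have "continuous_map X X c"
    using xy by (simp add: c_def)
  ultimately show ?thesis
    unfolding is_alpha_limit_set_def using xy by blast
qed

lemma clopen_is_alpha_limit_set:
  assumes "openin X A" "closedin X A" "A \<noteq> {}"
  shows "is_alpha_limit_set X A"
proof -
  obtain x where x: "x \<in> A"
    using assms by blast
  have sub: "A \<subseteq> topspace X"
    using assms closedin_subset by blast
  \<comment> \<open>For \<open>A = topspace X\<close> the second value is never taken and only has to be a point of the space.\<close>
  obtain y where y: "y \<in> topspace X" "A \<noteq> topspace X \<Longrightarrow> y \<notin> A"
    using x sub by blast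
  define f where "f = (\<lambda>z. if z \<in> A then x else y)"
  have "openin X {z \<in> topspace X. f z \<in> W}" for W
  proof -
    have "{z \<in> topspace X. f z \<in> W}
        = (if x \<in> W then A else {}) \<union> (if y \<in> W then topspace X - A else {})"
      using sub by (auto simp: f_def split: if_splits)
    moreover have "openin X (topspace X - A)"
      using assms by blast
    ultimately show ?thesis
      using assms by (auto intro: openin_Un)
  qed
  then have "continuous_map X X f"
    using x y sub by (auto simp: continuous_map f_def)
  moreover have "alpha_limit X f x = A"
  proof (rule alpha_limit_collapse)
    show "f \<in> topspace X - A \<rightarrow> topspace X - A"
      using y by (cases "A = topspace X") (auto simp: f_def)
  qed (use assms x in \<open>auto simp: f_def\<close>)
  ultimately show ?thesis
    using x sub unfolding is_alpha_limit_set_def by blast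
qed

lemma nonopen_is_alpha_limit_set:
  assumes met: "metrizable_space X" and zero: "zero_dimensional_space X"
    and count: "second_countable X" and A: "closedin X A" and nonopen: "\<not> openin X A"
  shows "is_alpha_limit_set X A"
proof -
  obtain M d where M: "Metric_space M d" "X = Metric_space.mtopology M d"
    using met unfolding metrizable_space_def by blast
  have sub: "A \<subseteq> topspace X"
    using A closedin_subset by blast
  obtain x where x: "x \<in> A" "x \<notin> X interior_of A"
    using nonopen by (metis interior_of_subset openin_interior_of subsetI subset_antisym)
  then have "x \<in> X closure_of (topspace X - A)"
    using sub by (auto simp: closure_of_complement)
  then obtain y where y: "range y \<subseteq> topspace X - A" and lim: "limitin X y x sequentially"
    using Metric_space.closure_of_sequentially[OF M(1)] M(2) by auto
  obtain P :: "nat \<Rightarrow> 'a set" where P: "\<And>n. openin X (P n)" "\<And>n. closedin X (P n)"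
      "(\<Union>n. P n) = topspace X - A" and disj: "disjoint_family P"
    using open_eq_disjoint_UN_clopen[OF zero count, of "topspace X - A"] A by blast
  define f where "f = (\<lambda>z. if z \<in> A then x else y (THE n. z \<in> P n))"
  have fP: "f z = y n" if "z \<in> P n" for z n
  proof -
    have "(THE m. z \<in> P m) = n"
      using that disj by (intro the_equality) (auto simp: disjoint_family_on_def)
    moreover have "z \<notin> A" using that P(3) by blast
    ultimately show ?thesis by (simp add: f_def)
  qed
  have "continuous_map X X f"
    by (rule continuous_map_collapse_pieces[OF P _ _ lim]) (use x y sub fP in \<open>auto simp: f_def\<close>)
  moreover have "alpha_limit X f x = A"
    by (rule alpha_limit_collapse) (use A x y in \<open>auto simp: f_def image_subset_iff\<close>)
  ultimately show ?thesis
    using x sub unfolding is_alpha_limit_set_def by blast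
qed

theorem zero_dimensional_AF_property:
  assumes "metrizable_space X" "nondegenerate_space X" "zero_dimensional_space X"
    "second_countable X"
  shows "AF_property X"
proof -
  have "is_alpha_limit_set X A" if "closedin X A" for A
    using empty_is_alpha_limit_set[of X] clopen_is_alpha_limit_set[of X A]
      nonopen_is_alpha_limit_set[of X A] assms that by blast
  moreover have "closedin X A" if "is_alpha_limit_set X A" for A
    using that closedin_alpha_limit unfolding is_alpha_limit_set_def by metis
  ultimately show ?thesis
    using assms unfolding AF_property_def by blast
qed

section \<open>Separable metric spaces and the Cantor space\<close>

text \<open>The base consists of the balls with radius \<open>1 / (n + 1)\<close> around the points of a countable dense set.\<close>
lemma (in Metric_space) separable_imp_second_countable:
  assumes "separable_space mtopology"
  shows "second_countable mtopology"
proof -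
  obtain C where C: "countable C" "C \<subseteq> M" "mtopology closure_of C = M"
    using assms unfolding separable_space_def by auto
  define \<B> where "\<B> = (\<lambda>(c, n). mball c (inverse (real (Suc n)))) ` (C \<times> UNIV)"
  have "\<exists>V\<in>\<B>. x \<in> V \<and> V \<subseteq> U" if U: "openin mtopology U" "x \<in> U" for U x
  proof -
    obtain r where r: "r > 0" "mball x r \<subseteq> U"
      using U by (meson openin_mtopology)
    have x: "x \<in> M"
      using U openin_mtopology by blast
    \<comment> \<open>Half the radius, so that a ball containing \<open>x\<close> stays within distance \<open>r\<close> of \<open>x\<close>.\<close>
    obtain n where n: "inverse (real (Suc n)) < r / 2"
      using r reals_Archimedean[of "r / 2"] by auto
    have "x \<in> mtopology closure_of C"
      using C x by simp
    then obtain c where c: "c \<in> C" "c \<in> mball x (inverse (real (Suc n)))"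
      unfolding metric_closure_of using inverse_Suc[of n] by blast
    have "mball c (inverse (real (Suc n))) \<subseteq> mball x r"
      using c n by (intro mball_subset) (auto simp: commute)
    then show ?thesis
      using c r x unfolding \<B>_def
      by (intro bexI[of _ "mball c (inverse (real (Suc n)))"]) (auto simp: commute)
  qed
  moreover have "countable \<B>"
    unfolding \<B>_def using C by auto
  moreover have "\<forall>V\<in>\<B>. openin mtopology V"
    unfolding \<B>_def by auto
  ultimately show ?thesis
    unfolding second_countable_def by blast
qed

text \<open>
  Cylinders over finite bit strings form a base of the Cantor space that is countable and consists
  of clopen sets, so they give zero-dimensionality and second countability at the same time.
\<close>
definition cylinder :: "bool list \<Rightarrow> (nat \<Rightarrow> bool) set" where
  "cylinder s = {x. \<forall>i<length s. x i = s ! i}"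

lemma cylinder_eq_PiE: "cylinder s = Pi\<^sub>E UNIV (\<lambda>i. if i < length s then {s ! i} else UNIV)"
  by (auto simp: cylinder_def PiE_iff split: if_splits)

lemma clopen_cylinder: "openin Cantor_space (cylinder s) \<and> closedin Cantor_space (cylinder s)"
proof
  have "{i. (if i < length s then {s ! i} else UNIV) \<noteq> UNIV} \<subseteq> {..<length s}"
    by auto
  then have "finite {i. (if i < length s then {s ! i} else UNIV) \<noteq> UNIV}"
    by (rule finite_subset) simp
  then show "openin Cantor_space (cylinder s)"
    unfolding Cantor_space_def cylinder_eq_PiE by (intro product_topology_basis) auto
  show "closedin Cantor_space (cylinder s)"
    unfolding Cantor_space_def cylinder_eq_PiE by (auto simp: closedin_product_topology)
qed

lemma cylinder_base:
  assumes "openin Cantor_space U" "x \<in> U"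
  shows "\<exists>V\<in>range cylinder. x \<in> V \<and> V \<subseteq> U"
proof -
  obtain Y where Y: "x \<in> Pi\<^sub>E UNIV Y" "finite {i. Y i \<noteq> UNIV}" "Pi\<^sub>E UNIV Y \<subseteq> U"
    using product_topology_open_contains_basis[OF assms[unfolded Cantor_space_def]] by auto
  obtain n where n: "{i. Y i \<noteq> UNIV} \<subseteq> {..<n}"
    using Y(2) finite_nat_iff_bounded by blast
  have "cylinder (map x [0..<n]) \<subseteq> Pi\<^sub>E UNIV Y"
  proof
    fix z assume "z \<in> cylinder (map x [0..<n])"
    then have "z i = x i" if "i < n" for i
      using that by (simp add: cylinder_def)
    then have "z i \<in> Y i" for i
      using n Y(1) by (cases "i < n") (auto simp: PiE_iff)
    then show "z \<in> Pi\<^sub>E UNIV Y"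
      by (simp add: PiE_iff)
  qed
  moreover have "x \<in> cylinder (map x [0..<n])"
    by (simp add: cylinder_def)
  ultimately show ?thesis
    using Y(3) by blast
qed

lemma AF_property_Cantor_space: "AF_property Cantor_space"
proof (rule zero_dimensional_AF_property)
  show "metrizable_space Cantor_space"
    unfolding Cantor_space_def by (simp add: metrizable_space_product_topology)
  have "(\<lambda>_. True) \<noteq> (\<lambda>_::nat. False)"
    by metis
  then show "nondegenerate_space Cantor_space"
    unfolding nondegenerate_space_def Cantor_space_def by auto
  show "zero_dimensional_space Cantor_space"
    unfolding zero_dimensional_space_def
    by (rule exI[of _ "range cylinder"]) (use clopen_cylinder cylinder_base in blast)
  show "second_countable Cantor_space"
    unfolding second_countable_def
    by (rule exI[of _ "range cylinder"]) (use clopen_cylinder cylinder_base in blast)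
qed

theorem proposition10:
  shows "(\<forall>(X :: 'a set) d.
            Metric_space X d \<and>
            nondegenerate_space (Metric_space.mtopology X d) \<and>
            zero_dimensional_space (Metric_space.mtopology X d) \<and>
            separable_space (Metric_space.mtopology X d)
            \<longrightarrow> AF_property (Metric_space.mtopology X d))
         \<and> AF_property Cantor_space"
  using zero_dimensional_AF_property AF_property_Cantor_space
    Metric_space.separable_imp_second_countable Metric_space.metrizable_space_mtopology
  by blast

end
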